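(* Let $p:\Omega\to\Lambda$ be a covering of $k$-graphs, $x\in\Lambda^0$, and $v\in p^{-1}(x)$. Then $p_*$ maps the fundamental group $\pi(\Omega,v)$ isomorphically onto the stability group $S_v$ of the corresponding groupoid action $(\Omega^0,\mathcal G(\Lambda))$.
   Context: A $k$-graph is a small category $\Lambda$ with a functor $d:\Lambda\to\mathbb N^k$ (the degree) satisfying the factorization property: if $d(\alpha)=n+l$ with $n,l\in\mathbb N^k$, there are unique $\beta,\gamma\in\Lambda$ with $d(\beta)=n$, $d(\gamma)=l$, $\alpha=\beta\gamma$. $\Lambda^0$ is the set of objects (vertices, identified with identity morphisms); $s(\alpha)$ and $r(\alpha)$ are the domain and codomain of $\alpha$. $u\mathcal C=r^{-1}(u)$, $\mathcal C v=s^{-1}(v)$, $u\mathcal Cv=u\mathcal C\cap\mathcal Cv$. A $k$-graph morphism is a degree-preserving functor. A covering of $\Lambda$ is a surjective $k$-graph morphism $p:\Omega\to\Lambda$ such that for all $v\in\Omega^0$, $p$ maps $\Omega v$ bijectively onto $\Lambda p(v)$ and $v\Omega$ bijectively onto $p(v)\Lambda$. The fundamental groupoid of $\Lambda$ is the groupoid $\mathcal G(\Lambda)$ with $\mathcal G(\Lambda)^0=\Lambda^0$, together with a functor $i:\Lambda\to\mathcal G(\Lambda)$ that is the identity on $\Lambda^0$, such that every functor from $\Lambda$ to a groupoid factors uniquely through $i$. The fundamental group at $x\in\Lambda^0$ is $\pi(\Lambda,x)=x\mathcal G(\Lambda)x$. $p_*:\mathcal G(\Omega)\to\mathcal G(\Lambda)$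 is the groupoid morphism induced by $p$ by functoriality. An action of a groupoid $\mathcal G$ on a set $V$ is a functor $T$ from $\mathcal G$ to sets such that $V$ is the disjoint union of the sets $V_x:=T(x)$, $x\in\mathcal G^0$; write $av=T(a)(v)$ for $v\in V_{s(a)}$. The stability group at $v\in V$ is $S_v=\{a\in\mathcal G\mid av=v\}$. The action corresponding to a covering $p:\Omega\to\Lambda$ is the unique action of $\mathcal G(\Lambda)$ on $\Omega^0$ (with fibres $p^{-1}(x)$, $x\in\Lambda^0$) such that $i(\alpha)v=r(\lambda)$ if $\alpha=p(\lambda)$ and $v=s(\lambda)$, $\lambda\in\Omega$. *)

theory Defs
  imports
    "HOL-Library.FuncSet"
    "HOL-Library.Disjoint_Sets"
    "HOL-Analysis.Finite_Cartesian_Product"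
    "HOL-Algebra.Group"
begin

section \<open>Categories, groupoids, functors\<close>

text \<open>Arrows compose like functions: \<open>cmp C a b\<close> is the product \<open>ab\<close> and is meaningful when
  \<open>src C a = rng C b\<close>. Objects are kept apart from identity arrows, so a functor has an object
  map and an arrow map. Values outside the carriers \<open>obj C\<close>, \<open>arr C\<close> are irrelevant.\<close>

record ('o, 'a) cat =
  obj :: "'o set"
  arr :: "'a set"
  src :: "'a \<Rightarrow> 'o"
  rng :: "'a \<Rightarrow> 'o"
  ident :: "'o \<Rightarrow> 'a"
  cmp :: "'a \<Rightarrow> 'a \<Rightarrow> 'a"

locale category =
  fixes C :: "('o, 'a, 'z) cat_scheme"
  assumes src_obj: "a \<in> arr C \<Longrightarrow> src C a \<in> obj C"
    and rng_obj: "a \<in> arr C \<Longrightarrow> rng C a \<in> obj C"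
    and ident_arr: "x \<in> obj C \<Longrightarrow> ident C x \<in> arr C"
    and src_ident: "x \<in> obj C \<Longrightarrow> src C (ident C x) = x"
    and rng_ident: "x \<in> obj C \<Longrightarrow> rng C (ident C x) = x"
    and cmp_arr: "\<lbrakk>a \<in> arr C; b \<in> arr C; src C a = rng C b\<rbrakk> \<Longrightarrow> cmp C a b \<in> arr C"
    and src_cmp: "\<lbrakk>a \<in> arr C; b \<in> arr C; src C a = rng C b\<rbrakk> \<Longrightarrow> src C (cmp C a b) = src C b"
    and rng_cmp: "\<lbrakk>a \<in> arr C; b \<in> arr C; src C a = rng C b\<rbrakk> \<Longrightarrow> rng C (cmp C a b) = rng C a"
    and cmp_ident_left: "a \<in> arr C \<Longrightarrow> cmp C (ident C (rng C a)) a = a"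
    and cmp_ident_right: "a \<in> arr C \<Longrightarrow> cmp C a (ident C (src C a)) = a"
    and cmp_assoc: "\<lbrakk>a \<in> arr C; b \<in> arr C; c \<in> arr C; src C a = rng C b; src C b = rng C c\<rbrakk>
      \<Longrightarrow> cmp C (cmp C a b) c = cmp C a (cmp C b c)"

locale groupoid = category +
  assumes ex_inverse: "a \<in> arr C \<Longrightarrow> \<exists>b \<in> arr C. src C b = rng C a \<and> rng C b = src C a
      \<and> cmp C b a = ident C (src C a) \<and> cmp C a b = ident C (rng C a)"

locale cat_functor =
  dom: category C + cod: category D
  for C :: "('o, 'a, 'z) cat_scheme" and D :: "('p, 'b, 'y) cat_scheme" +
  fixes FO :: "'o \<Rightarrow> 'p" and FA :: "'a \<Rightarrow> 'b"
  assumes map_obj: "x \<in> obj C \<Longrightarrow> FO x \<in> obj D"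
    and map_arr: "a \<in> arr C \<Longrightarrow> FA a \<in> arr D"
    and map_src: "a \<in> arr C \<Longrightarrow> src D (FA a) = FO (src C a)"
    and map_rng: "a \<in> arr C \<Longrightarrow> rng D (FA a) = FO (rng C a)"
    and map_ident: "x \<in> obj C \<Longrightarrow> FA (ident C x) = ident D (FO x)"
    and map_cmp: "\<lbrakk>a \<in> arr C; b \<in> arr C; src C a = rng C b\<rbrakk>
      \<Longrightarrow> FA (cmp C a b) = cmp D (FA a) (FA b)"

definition vertex_group :: "('o, 'a, 'z) cat_scheme \<Rightarrow> 'o \<Rightarrow> 'a monoid" where
  "vertex_group G x = \<lparr>carrier = {a \<in> arr G. rng G a = x \<and> src G a = x},
    mult = cmp G, one = ident G x\<rparr>"


section \<open>Higher-rank graphs and coverings\<close>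

record ('o, 'a, 'k) kgraph = "('o, 'a) cat" +
  degree :: "'a \<Rightarrow> nat ^ 'k"

text \<open>The rank is \<open>k = CARD('k)\<close>.\<close>

locale k_graph = category L for L :: "('o, 'a, 'k::finite) kgraph" +
  assumes degree_ident: "x \<in> obj L \<Longrightarrow> degree L (ident L x) = 0"
    and degree_cmp: "\<lbrakk>a \<in> arr L; b \<in> arr L; src L a = rng L b\<rbrakk>
      \<Longrightarrow> degree L (cmp L a b) = degree L a + degree L b"
    and factorization: "\<lbrakk>a \<in> arr L; degree L a = n + l\<rbrakk>
      \<Longrightarrow> \<exists>!(b, c). b \<in> arr L \<and> c \<in> arr L \<and> src L b = rng L c
            \<and> degree L b = n \<and> degree L c = l \<and> a = cmp L b c"

locale k_graph_morphism =
  dom: k_graph Om + cod: k_graph La + cat_functor Om La pO pA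
  for Om :: "('o, 'a, 'k::finite) kgraph" and La :: "('p, 'b, 'k) kgraph" and pO pA +
  assumes map_degree: "a \<in> arr Om \<Longrightarrow> degree La (pA a) = degree Om a"

locale k_graph_covering = k_graph_morphism +
  assumes surj_obj: "pO ` obj Om = obj La"
    and surj_arr: "pA ` arr Om = arr La"
    and bij_src: "v \<in> obj Om \<Longrightarrow>
      bij_betw pA {a \<in> arr Om. src Om a = v} {b \<in> arr La. src La b = pO v}"
    and bij_rng: "v \<in> obj Om \<Longrightarrow>
      bij_betw pA {a \<in> arr Om. rng Om a = v} {b \<in> arr La. rng La b = pO v}"


section \<open>The fundamental groupoid\<close>

text \<open>The fundamental groupoid is the universal groupoid under \<open>C\<close>. Since a definition cannot
  quantify over the types carrying the target groupoids, a model is built here, and the universal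
  property is proved below for targets over arbitrary types
  (\<open>fundamental_groupoid_universal\<close>).

  A word \<open>[(a1, e1), \<dots>, (an, en)]\<close> stands for the formal product \<open>a1^e1 \<dots> an^en\<close>, where
  the exponent is \<open>1\<close> for \<open>True\<close> and \<open>-1\<close> for \<open>False\<close>; \<open>is_walk C y w x\<close> says that \<open>w\<close> is
  composable with range \<open>y\<close> and source \<open>x\<close>.\<close>

fun is_walk :: "('o, 'a, 'z) cat_scheme \<Rightarrow> 'o \<Rightarrow> ('a \<times> bool) list \<Rightarrow> 'o \<Rightarrow> bool" where
  "is_walk C y [] x \<longleftrightarrow> y = x \<and> x \<in> obj C"
| "is_walk C y ((a, e) # w) x \<longleftrightarrow> a \<in> arr C \<and> y = (if e then rng C a else src C a)
      \<and> is_walk C (if e then src C a else rng C a) w x"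

inductive basic_rel :: "('o, 'a, 'z) cat_scheme \<Rightarrow> ('a \<times> bool) list \<Rightarrow> ('a \<times> bool) list \<Rightarrow> bool"
  for C where
  basic_ident: "x \<in> obj C \<Longrightarrow> basic_rel C [(ident C x, True)] []"
| basic_cmp: "\<lbrakk>a \<in> arr C; b \<in> arr C; src C a = rng C b\<rbrakk>
    \<Longrightarrow> basic_rel C [(a, True), (b, True)] [(cmp C a b, True)]"
| basic_inv: "a \<in> arr C \<Longrightarrow> basic_rel C [(a, e), (a, \<not> e)] []"

inductive walk_eq :: "('o, 'a, 'z) cat_scheme \<Rightarrow> 'o \<Rightarrow> 'o \<Rightarrow> ('a \<times> bool) list \<Rightarrow> ('a \<times> bool) list \<Rightarrow> bool"
  for C y x where
  walk_refl: "is_walk C y w x \<Longrightarrow> walk_eq C y x w w"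
| walk_sym: "walk_eq C y x w w' \<Longrightarrow> walk_eq C y x w' w"
| walk_trans: "\<lbrakk>walk_eq C y x w w'; walk_eq C y x w' w''\<rbrakk> \<Longrightarrow> walk_eq C y x w w''"
| walk_step: "\<lbrakk>basic_rel C w w'; is_walk C y (u @ w @ u') x; is_walk C y (u @ w' @ u') x\<rbrakk>
    \<Longrightarrow> walk_eq C y x (u @ w @ u') (u @ w' @ u')"

type_synonym ('o, 'a) walk_class = "'o \<times> ('a \<times> bool) list set \<times> 'o"

definition walk_class :: "('o, 'a, 'z) cat_scheme \<Rightarrow> 'o \<Rightarrow> ('a \<times> bool) list \<Rightarrow> 'o \<Rightarrow> ('o, 'a) walk_class"
  where "walk_class C y w x = (y, {w'. walk_eq C y x w w'}, x)"

definition fundamental_groupoid :: "('o, 'a, 'z) cat_scheme \<Rightarrow> ('o, ('o, 'a) walk_class) cat" where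
  "fundamental_groupoid C = \<lparr>obj = obj C,
    arr = {walk_class C y w x | y w x. is_walk C y w x},
    src = (\<lambda>(y, W, x). x),
    rng = (\<lambda>(y, W, x). y),
    ident = (\<lambda>x. walk_class C x [] x),
    cmp = (\<lambda>(z, W, _) (_, W', x).
      (z, \<Union>w\<in>W. \<Union>w'\<in>W'. {w''. walk_eq C z x (w @ w') w''}, x))\<rparr>"

definition fg_incl :: "('o, 'a, 'z) cat_scheme \<Rightarrow> 'a \<Rightarrow> ('o, 'a) walk_class" where
  "fg_incl C a = walk_class C (rng C a) [(a, True)] (src C a)"

context category
begin

lemma is_walk_obj: "is_walk C y w x \<Longrightarrow> y \<in> obj C \<and> x \<in> obj C"
  by (induction w arbitrary: y) (auto split: if_splits intro: src_obj rng_obj)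

lemma is_walk_append: "is_walk C y (u @ w) x \<longleftrightarrow> (\<exists>z. is_walk C y u z \<and> is_walk C z w x)"
proof (induction u arbitrary: y)
  case Nil
  then show ?case by (auto dest: is_walk_obj)
next
  case (Cons p u)
  then show ?case by (cases p) fastforce
qed

lemma is_walk_single: "a \<in> arr C \<Longrightarrow> is_walk C (rng C a) [(a, True)] (src C a)"
  by (simp add: src_obj)

lemma walk_eq_is_walk: "walk_eq C y x w w' \<Longrightarrow> is_walk C y w x \<and> is_walk C y w' x"
  by (induction rule: walk_eq.induct) auto

lemma walk_eq_context:
  "\<lbrakk>walk_eq C y x w w'; is_walk C y' u y; is_walk C x u' x'\<rbrakk>
    \<Longrightarrow> walk_eq C y' x' (u @ w @ u') (u @ w' @ u')"
proof (induction rule: walk_eq.induct)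
  case (walk_refl w)
  then show ?case by (intro walk_eq.walk_refl) (unfold is_walk_append, blast)
next
  case (walk_sym w w')
  then show ?case by (auto intro: walk_eq.walk_sym)
next
  case (walk_trans w w' w'')
  then show ?case by (auto intro: walk_eq.walk_trans)
next
  case (walk_step w w' t t')
  have "is_walk C y' ((u @ t) @ w @ (t' @ u')) x'" "is_walk C y' ((u @ t) @ w' @ (t' @ u')) x'"
    using walk_step(2-5) unfolding is_walk_append by blast+
  from walk_eq.walk_step[OF walk_step(1) this] show ?case by simp
qed

lemma walk_eq_append:
  assumes "walk_eq C z y u u'" "walk_eq C y x w w'"
  shows "walk_eq C z x (u @ w) (u' @ w')"
proof -
  have o: "y \<in> obj C" "x \<in> obj C" "is_walk C z u' y" "is_walk C y w x"
    using assms walk_eq_is_walk is_walk_obj by blast+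
  have "walk_eq C z x ([] @ u @ w) ([] @ u' @ w)"
    using o assms is_walk_obj by (intro walk_eq_context) auto
  moreover have "walk_eq C z x (u' @ w @ []) (u' @ w' @ [])"
    using o assms by (intro walk_eq_context) auto
  ultimately show ?thesis by (auto intro: walk_trans)
qed

lemma walk_class_eq_iff:
  assumes "is_walk C y w x"
  shows "walk_class C y w x = walk_class C y' w' x' \<longleftrightarrow> y = y' \<and> x = x' \<and> walk_eq C y x w w'"
  unfolding walk_class_def using assms
  by (auto intro: walk_refl walk_sym walk_trans)

lemma walk_class_cong: "walk_eq C y x w w' \<Longrightarrow> walk_class C y w x = walk_class C y w' x"
  unfolding walk_class_def by (auto intro: walk_sym walk_trans)

abbreviation "FG \<equiv> fundamental_groupoid C"

lemma fg_obj [simp]: "obj FG = obj C"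
  and fg_src [simp]: "src FG (walk_class C y w x) = x"
  and fg_rng [simp]: "rng FG (walk_class C y w x) = y"
  and fg_ident: "ident FG x = walk_class C x [] x"
  by (simp_all add: fundamental_groupoid_def walk_class_def)

lemma fg_arr: "is_walk C y w x \<Longrightarrow> walk_class C y w x \<in> arr FG"
  by (auto simp: fundamental_groupoid_def)

lemma fg_arrE:
  assumes "c \<in> arr FG"
  obtains y w x where "is_walk C y w x" "c = walk_class C y w x"
  using assms by (auto simp: fundamental_groupoid_def)

lemma fg_arrE':
  assumes "c \<in> arr FG" "rng FG c = y"
  obtains w x where "is_walk C y w x" "c = walk_class C y w x"
  using assms by (auto elim!: fg_arrE)

lemma fg_composableE:
  assumes "a \<in> arr FG" "b \<in> arr FG" "src FG a = rng FG b"
  obtains z u y w x where "is_walk C z u y" "is_walk C y w x"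
      "a = walk_class C z u y" "b = walk_class C y w x"
proof -
  obtain z u y where a: "is_walk C z u y" "a = walk_class C z u y" using assms(1) by (rule fg_arrE)
  then have "rng FG b = y" using assms(3) by simp
  with assms(2) obtain w x where "is_walk C y w x" "b = walk_class C y w x" by (rule fg_arrE')
  with a that show thesis by blast
qed

lemma fg_cmp_raw: "cmp FG (z, W, y) (y', W', x)
    = (z, \<Union>w\<in>W. \<Union>w'\<in>W'. {w''. walk_eq C z x (w @ w') w''}, x)"
  unfolding fundamental_groupoid_def by simp

lemma fg_cmp:
  assumes "is_walk C z u y" "is_walk C y w x"
  shows "cmp FG (walk_class C z u y) (walk_class C y w x) = walk_class C z (u @ w) x"
proof -
  have "(\<Union>u'\<in>{u'. walk_eq C z y u u'}. \<Union>w'\<in>{w'. walk_eq C y x w w'}. {v. walk_eq C z x (u' @ w') v})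
     = {v. walk_eq C z x (u @ w) v}" (is "?L = ?R")
  proof
    show "?L \<subseteq> ?R"
    proof clarify
      fix u' w' v assume "walk_eq C z y u u'" "walk_eq C y x w w'" "walk_eq C z x (u' @ w') v"
      then show "walk_eq C z x (u @ w) v" using walk_trans[OF walk_eq_append] by blast
    qed
    show "?R \<subseteq> ?L"
    proof
      fix v assume "v \<in> ?R"
      moreover have "u \<in> {u'. walk_eq C z y u u'}" "w \<in> {w'. walk_eq C y x w w'}"
        using assms by (auto intro: walk_refl)
      ultimately show "v \<in> ?L" by blast
    qed
  qed
  then show ?thesis unfolding walk_class_def fg_cmp_raw by (rule arg_cong)
qed

lemma category_fg: "category FG"
proof
  fix a b c assume "a \<in> arr FG" "b \<in> arr FG" "src FG a = rng FG b"
  then obtain z u y w x where ab: "is_walk C z u y" "is_walk C y w x"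
      "a = walk_class C z u y" "b = walk_class C y w x"
    by (rule fg_composableE)
  have uw: "is_walk C z (u @ w) x" using ab(1,2) unfolding is_walk_append by blast
  show "cmp FG a b \<in> arr FG" "src FG (cmp FG a b) = src FG b" "rng FG (cmp FG a b) = rng FG a"
    by (simp_all add: ab(3,4) fg_cmp[OF ab(1,2)] fg_arr[OF uw])
  assume "c \<in> arr FG" "src FG b = rng FG c"
  then have "rng FG c = x" using ab(4) by simp
  with \<open>c \<in> arr FG\<close> obtain t o' where c: "is_walk C x t o'" "c = walk_class C x t o'"
    by (rule fg_arrE')
  have wt: "is_walk C y (w @ t) o'" using ab(2) c(1) unfolding is_walk_append by blast
  show "cmp FG (cmp FG a b) c = cmp FG a (cmp FG b c)"
    by (simp add: ab(3,4) c(2) fg_cmp[OF ab(1,2)] fg_cmp[OF ab(2) c(1)] fg_cmp[OF uw c(1)] fg_cmp[OF ab(1) wt])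
next
  fix a assume "a \<in> arr FG"
  then obtain y w x where a: "is_walk C y w x" "a = walk_class C y w x" by (rule fg_arrE)
  then have "y \<in> obj C" "x \<in> obj C" using is_walk_obj by blast+
  then have e: "is_walk C y [] y" "is_walk C x [] x" by simp_all
  show "src FG a \<in> obj FG" "rng FG a \<in> obj FG"
    using e by (simp_all add: a(2))
  show "cmp FG (ident FG (rng FG a)) a = a" "cmp FG a (ident FG (src FG a)) = a"
    by (simp_all add: a(2) fg_ident fg_cmp[OF e(1) a(1)] fg_cmp[OF a(1) e(2)])
next
  fix x assume "x \<in> obj FG"
  then have "is_walk C x [] x" by simp
  then show "ident FG x \<in> arr FG" unfolding fg_ident by (rule fg_arr)
next
  fix x show "src FG (ident FG x) = x" "rng FG (ident FG x) = x"
    unfolding fg_ident by (rule fg_src, rule fg_rng)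
qed

lemma fg_single_inverse:
  assumes "a \<in> arr C"
  shows "walk_eq C (rng C a) (rng C a) [(a, True), (a, False)] []"
    and "walk_eq C (src C a) (src C a) [(a, False), (a, True)] []"
  using walk_step[OF basic_inv[OF assms, of True], of "rng C a" "[]" "[]" "rng C a"]
    walk_step[OF basic_inv[OF assms, of False], of "src C a" "[]" "[]" "src C a"] assms
  by (simp_all add: rng_obj src_obj)

lemma walk_inverse:
  "is_walk C y w x \<Longrightarrow> \<exists>w'. is_walk C x w' y \<and> walk_eq C y y (w @ w') [] \<and> walk_eq C x x (w' @ w) []"
proof (induction w arbitrary: y)
  case Nil
  then show ?case by (intro exI[of _ "[]"]) (auto intro: walk_refl)
next
  case (Cons p w)
  obtain a e where p: "p = (a, e)" by force
  define z where "z = (if e then src C a else rng C a)"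
  have a: "a \<in> arr C" "y = (if e then rng C a else src C a)" and zw: "is_walk C z w x"
    using Cons.prems p by (auto simp: z_def)
  then obtain w' where w': "is_walk C x w' z" "walk_eq C z z (w @ w') []" "walk_eq C x x (w' @ w) []"
    using Cons.IH by blast
  have yo: "y \<in> obj C" "z \<in> obj C" using a zw is_walk_obj src_obj rng_obj by auto
  have 1: "is_walk C y [(a, e)] z" "is_walk C z [(a, \<not> e)] y" using a yo by (auto simp: z_def)
  have e1: "walk_eq C y y ([(a, e)] @ [(a, \<not> e)]) []" "walk_eq C z z ([(a, \<not> e)] @ [(a, e)]) []"
    using fg_single_inverse[OF a(1)] a(2) by (cases e; simp add: z_def)+
  have "walk_eq C y y ([(a, e)] @ (w @ w') @ [(a, \<not> e)]) ([(a, e)] @ [] @ [(a, \<not> e)])"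
    by (rule walk_eq_context[OF w'(2) 1])
  then have "walk_eq C y y (((a, e) # w) @ (w' @ [(a, \<not> e)])) []"
    using e1(1) by (auto intro: walk_trans)
  moreover have "walk_eq C x x (w' @ ([(a, \<not> e)] @ [(a, e)]) @ w) (w' @ [] @ w)"
    by (rule walk_eq_context[OF e1(2) w'(1) zw])
  then have "walk_eq C x x ((w' @ [(a, \<not> e)]) @ ((a, e) # w)) []"
    using w'(3) by (auto intro: walk_trans)
  moreover have "is_walk C x (w' @ [(a, \<not> e)]) y" using w' 1 is_walk_append by blast
  ultimately show ?case using p by blast
qed

lemma groupoid_fundamental_groupoid: "groupoid (fundamental_groupoid C)"
proof -
  interpret F: category FG by (rule category_fg)
  show ?thesis
  proof
    fix a assume "a \<in> arr FG"
    then obtain y w x where a: "is_walk C y w x" "a = walk_class C y w x" by (rule fg_arrE)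
    from walk_inverse[OF a(1)] obtain w' where w': "is_walk C x w' y"
      "walk_eq C y y (w @ w') []" "walk_eq C x x (w' @ w) []" by blast
    then have "walk_class C y (w @ w') y = walk_class C y [] y"
      "walk_class C x (w' @ w) x = walk_class C x [] x"
      by (simp_all add: walk_class_cong)
    moreover have "walk_class C x w' y \<in> arr FG" by (rule fg_arr[OF w'(1)])
    ultimately show "\<exists>b \<in> arr FG. src FG b = rng FG a \<and> rng FG b = src FG a
      \<and> cmp FG b a = ident FG (src FG a) \<and> cmp FG a b = ident FG (rng FG a)"
      using fg_cmp[OF w'(1) a(1)] fg_cmp[OF a(1) w'(1)]
      by (intro bexI[of _ "walk_class C x w' y"]) (simp_all add: a(2) fg_ident)
  qed
qed

lemma fg_incl_arr: "a \<in> arr C \<Longrightarrow> fg_incl C a \<in> arr FG"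
  unfolding fg_incl_def by (intro fg_arr is_walk_single)

lemma fg_incl_src [simp]: "src FG (fg_incl C a) = src C a"
  and fg_incl_rng [simp]: "rng FG (fg_incl C a) = rng C a"
  by (simp_all add: fg_incl_def)

lemma fg_incl_functor: "cat_functor C (fundamental_groupoid C) (\<lambda>x. x) (fg_incl C)"
proof -
  interpret F: category FG by (rule category_fg)
  show ?thesis
  proof
    fix x assume x: "x \<in> obj C"
    then have "walk_eq C x x ([] @ [(ident C x, True)] @ []) ([] @ [] @ [])"
      by (intro walk_step basic_ident) (auto simp: ident_arr src_ident rng_ident)
    then show "fg_incl C (ident C x) = ident FG x"
      using x walk_class_cong[of x x "[(ident C x, True)]" "[]"]
      by (simp add: fg_incl_def fg_ident src_ident rng_ident)
  next
    fix a b assume ab: "a \<in> arr C" "b \<in> arr C" "src C a = rng C b"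
    then have "walk_eq C (rng C a) (src C b) ([] @ [(a, True), (b, True)] @ []) ([] @ [(cmp C a b, True)] @ [])"
      by (intro walk_step basic_cmp) (auto simp: cmp_arr src_cmp rng_cmp src_obj)
    then have "walk_class C (rng C a) [(cmp C a b, True)] (src C b)
        = walk_class C (rng C a) ([(a, True)] @ [(b, True)]) (src C b)"
      using walk_class_cong by simp
    then show "fg_incl C (cmp C a b) = cmp FG (fg_incl C a) (fg_incl C b)"
      using ab fg_cmp[of "rng C a" "[(a, True)]" "src C a" "[(b, True)]" "src C b"]
        is_walk_single[OF ab(1)] is_walk_single[OF ab(2)]
      by (simp add: fg_incl_def src_cmp rng_cmp)
  qed (auto intro: fg_incl_arr)
qed

lemma fg_induct [consumes 1, case_names ident incl inverse cmp]:
  assumes "c \<in> arr FG"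
    and ident: "\<And>x. x \<in> obj C \<Longrightarrow> P (ident FG x)"
    and incl: "\<And>a. a \<in> arr C \<Longrightarrow> P (fg_incl C a)"
    and inverse: "\<And>a b. \<lbrakk>a \<in> arr FG; b \<in> arr FG; src FG b = rng FG a; rng FG b = src FG a;
       cmp FG b a = ident FG (src FG a); cmp FG a b = ident FG (rng FG a); P a\<rbrakk> \<Longrightarrow> P b"
    and cmp: "\<And>a b. \<lbrakk>a \<in> arr FG; b \<in> arr FG; src FG a = rng FG b; P a; P b\<rbrakk> \<Longrightarrow> P (cmp FG a b)"
  shows "P c"
proof -
  have "P (walk_class C y w x)" if "is_walk C y w x" for y w x
    using that
  proof (induction w arbitrary: y)
    case Nil
    then show ?case using ident fg_ident by auto
  next
    case (Cons p w)
    obtain a e where p: "p = (a, e)" by force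
    define z where "z = (if e then src C a else rng C a)"
    have a: "a \<in> arr C" "y = (if e then rng C a else src C a)" and zw: "is_walk C z w x"
      using Cons.prems p by (auto simp: z_def)
    have w1: "is_walk C y [(a, e)] z" using a zw is_walk_obj by (auto simp: z_def)
    have "P (walk_class C y [(a, e)] z)"
    proof (cases e)
      case True
      then show ?thesis using a incl by (simp add: fg_incl_def z_def)
    next
      case False
      then have yz: "y = src C a" "z = rng C a" using a by (auto simp: z_def)
      have w2: "is_walk C z [(a, True)] y" using is_walk_single[OF a(1)] yz by simp
      have "P (walk_class C z [(a, True)] y)" using incl[OF a(1)] yz by (simp add: fg_incl_def)
      moreover have "walk_class C z ([(a, True)] @ [(a, e)]) z = walk_class C z [] z"
        "walk_class C y ([(a, e)] @ [(a, True)]) y = walk_class C y [] y"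
        using fg_single_inverse[OF a(1)] False yz walk_class_cong by simp_all
      ultimately show ?thesis
        using fg_cmp[OF w1 w2] fg_cmp[OF w2 w1]
        by (intro inverse[OF fg_arr[OF w2] fg_arr[OF w1]]) (simp_all add: fg_ident)
    qed
    from cmp[OF fg_arr[OF w1] fg_arr[OF zw] _ this Cons.IH[OF zw]]
    show ?case using fg_cmp[OF w1 zw] p by simp
  qed
  then show ?thesis using assms(1) by (auto elim: fg_arrE)
qed

end

definition gpd_inv :: "('o, 'a, 'z) cat_scheme \<Rightarrow> 'a \<Rightarrow> 'a" where
  "gpd_inv G a = (SOME b. b \<in> arr G \<and> src G b = rng G a \<and> rng G b = src G a
      \<and> cmp G b a = ident G (src G a) \<and> cmp G a b = ident G (rng G a))"

context groupoid
begin

lemma gpd_inv: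
  assumes "a \<in> arr C"
  shows "gpd_inv C a \<in> arr C" "src C (gpd_inv C a) = rng C a" "rng C (gpd_inv C a) = src C a"
    "cmp C (gpd_inv C a) a = ident C (src C a)" "cmp C a (gpd_inv C a) = ident C (rng C a)"
  using someI_ex[OF ex_inverse[OF assms, unfolded Bex_def]] unfolding gpd_inv_def by auto

lemma inverse_unique:
  assumes "a \<in> arr C" "b \<in> arr C" "c \<in> arr C" "src C b = rng C a" "rng C b = src C a"
    "cmp C b a = ident C (src C a)" "rng C c = src C a" "cmp C a c = ident C (rng C a)"
  shows "b = c"
  using assms cmp_assoc[of b a c] cmp_ident_left[of c] cmp_ident_right[of b] by simp

lemma group_vertex_group:
  assumes "x \<in> obj C"
  shows "group (vertex_group C x)"
proof (rule groupI)
  fix a assume "a \<in> carrier (vertex_group C x)"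
  then show "\<exists>b\<in>carrier (vertex_group C x). b \<otimes>\<^bsub>vertex_group C x\<^esub> a = \<one>\<^bsub>vertex_group C x\<^esub>"
    using gpd_inv[of a] by (auto simp: vertex_group_def)
next
  fix a assume "a \<in> carrier (vertex_group C x)"
  then show "\<one>\<^bsub>vertex_group C x\<^esub> \<otimes>\<^bsub>vertex_group C x\<^esub> a = a"
    using cmp_ident_left[of a] by (auto simp: vertex_group_def)
qed (use assms in \<open>auto simp: vertex_group_def cmp_arr src_cmp rng_cmp cmp_assoc ident_arr src_ident rng_ident\<close>)

end

lemma cat_functor_inverse:
  assumes "cat_functor G H FO FA" "groupoid H" "a \<in> arr G" "b \<in> arr G" "src G b = rng G a"
    "rng G b = src G a" "cmp G b a = ident G (src G a)"
  shows "FA b = gpd_inv H (FA a)"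
proof -
  interpret cat_functor G H FO FA by fact
  interpret H: groupoid H by fact
  show ?thesis
    using assms map_cmp[of b a] H.gpd_inv[OF map_arr[OF assms(3)]]
    by (intro H.inverse_unique[OF map_arr[OF assms(3)] map_arr[OF assms(4)]])
       (auto simp: map_src map_rng map_ident dom.src_obj)
qed

fun walk_eval :: "('p, 'h, 'y) cat_scheme \<Rightarrow> ('o \<Rightarrow> 'p) \<Rightarrow> ('a \<Rightarrow> 'h) \<Rightarrow> ('a \<times> bool) list \<Rightarrow> 'o \<Rightarrow> 'h" where
  "walk_eval H fO fA [] x = ident H (fO x)"
| "walk_eval H fO fA ((a, e) # w) x =
     cmp H (if e then fA a else gpd_inv H (fA a)) (walk_eval H fO fA w x)"

locale functor_to_groupoid = cat_functor C H fO fA + cod: groupoid H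
  for C :: "('o, 'a, 'z) cat_scheme" and H :: "('p, 'h, 'y) cat_scheme" and fO fA
begin

abbreviation "ev \<equiv> walk_eval H fO fA"

lemma letter:
  assumes "a \<in> arr C"
  defines "l \<equiv> \<lambda>e. if e then fA a else gpd_inv H (fA a)"
  shows "l e \<in> arr H" "src H (l e) = fO (if e then src C a else rng C a)"
    "rng H (l e) = fO (if e then rng C a else src C a)"
    "cmp H (l e) (l (\<not> e)) = ident H (fO (if e then rng C a else src C a))"
  using assms cod.gpd_inv[OF map_arr[OF assms(1)]] by (auto simp: map_src map_rng map_arr)

lemma ev_arr: "is_walk C y w x \<Longrightarrow> ev w x \<in> arr H \<and> src H (ev w x) = fO x \<and> rng H (ev w x) = fO y"
proof (induction w arbitrary: y)
  case Nil
  then show ?case by (simp add: cod.ident_arr map_obj cod.src_ident cod.rng_ident)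
next
  case (Cons p w)
  obtain a e where p: "p = (a, e)" by force
  with Cons.prems have a: "a \<in> arr C" and w: "is_walk C (if e then src C a else rng C a) w x"
    and y: "y = (if e then rng C a else src C a)" by auto
  from letter[OF a, of e] Cons.IH[OF w] p y show ?case
    by (cases e) (simp_all add: cod.cmp_arr cod.src_cmp cod.rng_cmp)
qed

lemma ev_append:
  "\<lbrakk>is_walk C y u z; is_walk C z w x\<rbrakk> \<Longrightarrow> ev (u @ w) x = cmp H (ev u z) (ev w x)"
proof (induction u arbitrary: y)
  case Nil
  then show ?case using ev_arr[of z w x] cod.cmp_ident_left[of "ev w x"] by auto
next
  case (Cons p u)
  obtain a e where p: "p = (a, e)" by force
  with Cons.prems have a: "a \<in> arr C" and u: "is_walk C (if e then src C a else rng C a) u z" by auto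
  from letter[OF a, of e] Cons.IH[OF u Cons.prems(2)] ev_arr[OF u] ev_arr[OF Cons.prems(2)] p
  show ?case by (simp add: cod.cmp_assoc)
qed

lemma ev_basic:
  assumes "basic_rel C w w'" "is_walk C y w x" "is_walk C y w' x"
  shows "ev w x = ev w' x"
  using assms
proof (cases rule: basic_rel.cases)
  case (basic_ident z)
  then show ?thesis using assms cod.cmp_ident_left[OF cod.ident_arr[OF map_obj[of z]]]
    by (auto simp: map_ident map_obj dom.src_ident dom.rng_ident cod.rng_ident)
next
  case (basic_cmp a b)
  then have "x = src C b" using assms by simp
  have "cmp H (fA c) (ident H (fO x)) = fA c" if "c \<in> arr C" "src C c = x" for c
    using cod.cmp_ident_right[OF map_arr[OF that(1)]] that by (simp add: map_src)
  from this[of b] this[of "cmp C a b"] show ?thesis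
    using basic_cmp \<open>x = src C b\<close> by (simp add: map_cmp dom.cmp_arr dom.src_cmp)
next
  case (basic_inv a e)
  have x: "x = (if e then rng C a else src C a)" using assms basic_inv by (auto split: if_splits)
  have xo: "fO x \<in> obj H" using x basic_inv map_obj dom.src_obj dom.rng_obj by auto
  note l = letter[OF basic_inv(3)]
  have "cmp H (if \<not> e then fA a else gpd_inv H (fA a)) (ident H (fO x)) = (if \<not> e then fA a else gpd_inv H (fA a))"
    using cod.cmp_ident_right[OF l(1)[of "\<not> e"]] l(2)[of "\<not> e"] x by (auto split: if_splits)
  then show ?thesis using l(4)[of e] x basic_inv by simp
qed

lemma ev_cong: "walk_eq C y x w w' \<Longrightarrow> ev w x = ev w' x"
proof (induction rule: walk_eq.induct)
  case (walk_step w w' u u')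
  then obtain z z' where z: "is_walk C y u z" "is_walk C z w z'" "is_walk C z' u' x"
    by (auto simp: dom.is_walk_append)
  obtain t t' where t: "is_walk C y u t" "is_walk C t w' t'" "is_walk C t' u' x"
    using walk_step by (auto simp: dom.is_walk_append)
  have endp: "z = t" if "is_walk C y u z" "is_walk C y u t" for y u z t
    using that by (induction u arbitrary: y) auto
  have start: "z = t" if "is_walk C z u x" "is_walk C t u x" for z u x t
    using that by (cases u) auto
  have eq: "t = z" "t' = z'" using endp z t start by blast+
  have "is_walk C z (w @ u') x" "is_walk C z (w' @ u') x"
    using z t eq dom.is_walk_append by blast+
  then show ?case
    using z t eq ev_basic[OF walk_step(1)] by (simp add: ev_append)
qed auto

definition lift :: "('o, 'a) walk_class \<Rightarrow> 'h" where
  "lift = restrict (\<lambda>(y, W, x). ev (SOME w. w \<in> W) x) (arr (fundamental_groupoid C))"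

lemma lift_class: "is_walk C y w x \<Longrightarrow> lift (walk_class C y w x) = ev w x"
proof -
  assume w: "is_walk C y w x"
  have "walk_eq C y x w (SOME w'. walk_eq C y x w w')"
    by (rule someI) (rule walk_refl[OF w])
  from ev_cong[OF this] dom.fg_arr[OF w] show ?thesis by (simp add: lift_def walk_class_def)
qed

lemma lift_functor: "cat_functor (fundamental_groupoid C) H fO lift"
proof -
  interpret F: groupoid "fundamental_groupoid C" by (rule dom.groupoid_fundamental_groupoid)
  show ?thesis
  proof
    fix a assume "a \<in> arr (fundamental_groupoid C)"
    then obtain y w x where "is_walk C y w x" "a = walk_class C y w x" by (rule dom.fg_arrE)
    then show "lift a \<in> arr H" "src H (lift a) = fO (src (fundamental_groupoid C) a)"
      "rng H (lift a) = fO (rng (fundamental_groupoid C) a)"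
      using ev_arr by (auto simp: lift_class)
  next
    fix a b assume "a \<in> arr (fundamental_groupoid C)" "b \<in> arr (fundamental_groupoid C)"
      "src (fundamental_groupoid C) a = rng (fundamental_groupoid C) b"
    then obtain z u y w x where ab: "is_walk C z u y" "is_walk C y w x"
      "a = walk_class C z u y" "b = walk_class C y w x"
      by (rule dom.fg_composableE)
    moreover have "is_walk C z (u @ w) x" using ab dom.is_walk_append by blast
    ultimately show "lift (cmp (fundamental_groupoid C) a b) = cmp H (lift a) (lift b)"
      by (simp add: dom.fg_cmp lift_class ev_append)
  qed (auto simp: map_obj dom.fg_ident lift_class)
qed

lemma lift_incl: "a \<in> arr C \<Longrightarrow> lift (fg_incl C a) = fA a"
  using lift_class[OF dom.is_walk_single] cod.cmp_ident_right[OF map_arr[of a]]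
  by (simp add: fg_incl_def map_src)

end

lemma fg_functor_unique:
  assumes "category C" "groupoid H"
    and "cat_functor (fundamental_groupoid C) H fO F" "cat_functor (fundamental_groupoid C) H fO F'"
    and "\<And>a. a \<in> arr C \<Longrightarrow> F (fg_incl C a) = F' (fg_incl C a)"
    and "c \<in> arr (fundamental_groupoid C)"
  shows "F c = F' c"
proof -
  interpret category C by fact
  interpret F: cat_functor "fundamental_groupoid C" H fO F by fact
  interpret F': cat_functor "fundamental_groupoid C" H fO F' by fact
  show ?thesis using assms(6)
  proof (induction rule: fg_induct)
    case (ident x)
    then show ?case by (simp add: F.map_ident F'.map_ident)
  next
    case (incl a)
    then show ?case by (rule assms)
  next
    case (inverse a b)
    then show ?case using cat_functor_inverse[OF assms(3,2), of a b] cat_functor_inverse[OF assms(4,2), of a b] by simp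
  next
    case (cmp a b)
    then show ?case by (simp add: F.map_cmp F'.map_cmp)
  qed
qed

text \<open>As the inclusion is the identity on objects, the object map of the factoring functor is
  forced to be that of the given functor.\<close>

lemma fundamental_groupoid_universal:
  assumes "groupoid H" "cat_functor C H fO fA"
  shows "\<exists>!F. F \<in> extensional (arr (fundamental_groupoid C))
    \<and> cat_functor (fundamental_groupoid C) H fO F \<and> (\<forall>a \<in> arr C. F (fg_incl C a) = fA a)"
proof -
  interpret functor_to_groupoid C H fO fA
    using assms by (simp add: functor_to_groupoid_def)
  show ?thesis
  proof (rule ex1I[of _ lift])
    show "lift \<in> extensional (arr (fundamental_groupoid C))
      \<and> cat_functor (fundamental_groupoid C) H fO lift \<and> (\<forall>a \<in> arr C. lift (fg_incl C a) = fA a)"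
      using lift_functor lift_incl by (auto simp: lift_def)
    fix F assume F: "F \<in> extensional (arr (fundamental_groupoid C))
      \<and> cat_functor (fundamental_groupoid C) H fO F \<and> (\<forall>a \<in> arr C. F (fg_incl C a) = fA a)"
    show "F = lift"
    proof (rule extensionalityI[of _ "arr (fundamental_groupoid C)"])
      show "lift \<in> extensional (arr (fundamental_groupoid C))" by (simp add: lift_def)
      show "F c = lift c" if "c \<in> arr (fundamental_groupoid C)" for c
        using fg_functor_unique[OF dom.category_axioms assms(1) _ lift_functor _ that, of F] F lift_incl by auto
    qed (use F in auto)
  qed
qed

definition fundamental_group ::
  "('o, 'a, 'z) cat_scheme \<Rightarrow> 'o \<Rightarrow> ('o, 'a) walk_class monoid" where
  "fundamental_group C x = vertex_group (fundamental_groupoid C) x"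

text \<open>Arrow map of the induced functor, whose object map is \<open>pO\<close>; see the lemma \<open>fg_map\<close>.\<close>

definition fg_map :: "('o, 'a, 'z) cat_scheme \<Rightarrow> ('p, 'b, 'y) cat_scheme \<Rightarrow> ('o \<Rightarrow> 'p) \<Rightarrow> ('a \<Rightarrow> 'b)
    \<Rightarrow> ('o, 'a) walk_class \<Rightarrow> ('p, 'b) walk_class" where
  "fg_map C D pO pA = (THE F. F \<in> extensional (arr (fundamental_groupoid C))
     \<and> cat_functor (fundamental_groupoid C) (fundamental_groupoid D) pO F
     \<and> (\<forall>a \<in> arr C. F (fg_incl C a) = fg_incl D (pA a)))"


lemma fg_map:
  assumes "cat_functor C D pO pA"
  shows "fg_map C D pO pA \<in> extensional (arr (fundamental_groupoid C))"
    and "cat_functor (fundamental_groupoid C) (fundamental_groupoid D) pO (fg_map C D pO pA)"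
    and "a \<in> arr C \<Longrightarrow> fg_map C D pO pA (fg_incl C a) = fg_incl D (pA a)"
proof -
  interpret cat_functor C D pO pA by fact
  interpret i: cat_functor D "fundamental_groupoid D" "\<lambda>x. x" "fg_incl D"
    by (rule cod.fg_incl_functor)
  have f: "cat_functor C (fundamental_groupoid D) pO (\<lambda>a. fg_incl D (pA a))"
    by unfold_locales (simp_all add: map_obj map_arr map_src map_rng map_ident map_cmp
      i.map_obj i.map_arr i.map_ident i.map_cmp cod.fg_incl_arr del: cod.fg_obj)
  note * = theI'[OF fundamental_groupoid_universal[OF cod.groupoid_fundamental_groupoid f],
      folded fg_map_def]
  show "fg_map C D pO pA \<in> extensional (arr (fundamental_groupoid C))"
    "cat_functor (fundamental_groupoid C) (fundamental_groupoid D) pO (fg_map C D pO pA)"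
    "a \<in> arr C \<Longrightarrow> fg_map C D pO pA (fg_incl C a) = fg_incl D (pA a)"
    using * by blast+
qed

lemma (in category) group_fundamental_group:
  "x \<in> obj C \<Longrightarrow> group (fundamental_group C x)"
  unfolding fundamental_group_def
  by (rule groupoid.group_vertex_group[OF groupoid_fundamental_groupoid]) simp


section \<open>Groupoid actions\<close>

text \<open>The functor to sets is \<open>x \<mapsto> VO x\<close>, \<open>a \<mapsto> T a\<close>; extensional functions play the role of maps
  between the sets \<open>VO x\<close>.\<close>

locale groupoid_action = groupoid G for G :: "('o, 'a, 'z) cat_scheme" +
  fixes V :: "'v set" and VO :: "'o \<Rightarrow> 'v set" and T :: "'a \<Rightarrow> 'v \<Rightarrow> 'v"
  assumes union: "V = (\<Union>x\<in>obj G. VO x)"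
    and disjoint: "disjoint_family_on VO (obj G)"
    and act_fun: "a \<in> arr G \<Longrightarrow> T a \<in> VO (src G a) \<rightarrow>\<^sub>E VO (rng G a)"
    and act_ident: "x \<in> obj G \<Longrightarrow> T (ident G x) = (\<lambda>v\<in>VO x. v)"
    and act_cmp: "\<lbrakk>a \<in> arr G; b \<in> arr G; src G a = rng G b\<rbrakk>
      \<Longrightarrow> T (cmp G a b) = compose (VO (src G b)) (T a) (T b)"

definition stability :: "('o, 'a, 'z) cat_scheme \<Rightarrow> ('o \<Rightarrow> 'v set) \<Rightarrow> ('a \<Rightarrow> 'v \<Rightarrow> 'v) \<Rightarrow> 'v \<Rightarrow> 'a set"
  where "stability G VO T v = {a \<in> arr G. v \<in> VO (src G a) \<and> T a v = v}"

lemma (in groupoid_action) subgroup_stability: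
  assumes "x \<in> obj G" "v \<in> VO x"
  shows "subgroup (stability G VO T v) (vertex_group G x)"
proof -
  interpret vg: group "vertex_group G x" using assms(1) by (rule group_vertex_group)
  have ends: "src G a = x" "rng G a = x" if "a \<in> stability G VO T v" for a
  proof -
    have a: "a \<in> arr G" "v \<in> VO (src G a)" "T a v = v" using that by (auto simp: stability_def)
    then have "v \<in> VO (rng G a)" using act_fun[OF a(1)] by (metis PiE_mem)
    then show "src G a = x" "rng G a = x"
      using a assms disjoint src_obj rng_obj by (auto simp: disjoint_family_on_def)
  qed
  have sub: "a \<in> carrier (vertex_group G x)" if "a \<in> stability G VO T v" for a
    using ends[OF that] that by (simp add: stability_def vertex_group_def)
  show ?thesis
  proof (rule vg.subgroupI)
    show "stability G VO T v \<subseteq> carrier (vertex_group G x)" using sub by blast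
    have "ident G x \<in> stability G VO T v"
      using assms by (simp add: stability_def ident_arr src_ident act_ident)
    then show "stability G VO T v \<noteq> {}" by blast
    show "a \<otimes>\<^bsub>vertex_group G x\<^esub> b \<in> stability G VO T v"
      if "a \<in> stability G VO T v" "b \<in> stability G VO T v" for a b
      using that ends[OF that(1)] ends[OF that(2)]
      by (simp add: stability_def vertex_group_def cmp_arr src_cmp act_cmp compose_def)
    show "inv\<^bsub>vertex_group G x\<^esub> a \<in> stability G VO T v" if a: "a \<in> stability G VO T v" for a
    proof -
      define b where "b = inv\<^bsub>vertex_group G x\<^esub> a"
      have b: "b \<in> carrier (vertex_group G x)" "b \<otimes>\<^bsub>vertex_group G x\<^esub> a = \<one>\<^bsub>vertex_group G x\<^esub>"
        using sub[OF a] by (simp_all add: b_def)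
      then have "T (cmp G b a) v = v"
        using assms by (simp add: vertex_group_def act_ident)
      then have "T b v = v"
        using a b ends[OF a] assms(2) act_cmp[of b a]
        by (simp add: stability_def vertex_group_def compose_def)
      then show ?thesis using b assms(2) by (simp add: b_def stability_def vertex_group_def)
    qed
  qed
qed

text \<open>The groupoid of bijections between the members of a family of sets.\<close>

definition bij_groupoid :: "'p set \<Rightarrow> ('p \<Rightarrow> 'v set) \<Rightarrow> ('p, 'p \<times> ('v \<Rightarrow> 'v) \<times> 'p) cat" where
  "bij_groupoid X F = \<lparr>obj = X,
    arr = {(y, f, x). x \<in> X \<and> y \<in> X \<and> f \<in> extensional (F x) \<and> bij_betw f (F x) (F y)},
    src = (\<lambda>(y, f, x). x),
    rng = (\<lambda>(y, f, x). y),
    ident = (\<lambda>x. (x, \<lambda>v\<in>F x. v, x)),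
    cmp = (\<lambda>(z, g, _) (_, f, x). (z, compose (F x) g f, x))\<rparr>"

lemma bij_groupoid_simps [simp]:
  "obj (bij_groupoid X F) = X"
  "(y, f, x) \<in> arr (bij_groupoid X F) \<longleftrightarrow>
     x \<in> X \<and> y \<in> X \<and> f \<in> extensional (F x) \<and> bij_betw f (F x) (F y)"
  "src (bij_groupoid X F) (y, f, x) = x"
  "rng (bij_groupoid X F) (y, f, x) = y"
  "ident (bij_groupoid X F) x = (x, \<lambda>v\<in>F x. v, x)"
  "cmp (bij_groupoid X F) (z, g, y') (y, f, x) = (z, compose (F x) g f, x)"
  by (simp_all add: bij_groupoid_def)

lemma bij_betw_compose: "\<lbrakk>bij_betw f A B; bij_betw g B D\<rbrakk> \<Longrightarrow> bij_betw (compose A g f) A D"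
  using bij_betw_trans[of f A B g D] bij_betw_cong[of A "compose A g f" "g \<circ> f" D]
  by (simp add: compose_def)

lemma groupoid_bij_groupoid: "groupoid (bij_groupoid X F)"
proof
  fix a :: "'a \<times> ('b \<Rightarrow> 'b) \<times> 'a"
  obtain y f x where a: "a = (y, f, x)" by (cases a)
  {
    assume "a \<in> arr (bij_groupoid X F)"
    with a have f: "x \<in> X" "y \<in> X" "f \<in> extensional (F x)" "bij_betw f (F x) (F y)" by auto
    then have "f \<in> F x \<rightarrow> F y" by (auto dest: bij_betwE)
    then have e: "compose (F x) (\<lambda>v\<in>F y. v) f = f" "compose (F x) f (\<lambda>v\<in>F x. v) = f"
      using f by (auto simp: compose_def fun_eq_iff extensional_def Pi_iff)
    show "src (bij_groupoid X F) a \<in> obj (bij_groupoid X F)"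
      "rng (bij_groupoid X F) a \<in> obj (bij_groupoid X F)"
      "cmp (bij_groupoid X F) (ident (bij_groupoid X F) (rng (bij_groupoid X F) a)) a = a"
      "cmp (bij_groupoid X F) a (ident (bij_groupoid X F) (src (bij_groupoid X F) a)) = a"
      using a f e by simp_all
    define g where "g = restrict (inv_into (F x) f) (F y)"
    have g: "bij_betw g (F y) (F x)" "g \<in> extensional (F y)"
      using bij_betw_inv_into[OF f(4)] bij_betw_cong[of "F y" g "inv_into (F x) f" "F x"]
      by (simp_all add: g_def)
    have "compose (F x) g f = (\<lambda>v\<in>F x. v)" "compose (F y) f g = (\<lambda>v\<in>F y. v)"
      unfolding compose_def g_def using f(4) bij_betwE[OF f(4)]
      by (auto simp: fun_eq_iff bij_betw_inv_into_left bij_betw_inv_into_right)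
    then show "\<exists>b\<in>arr (bij_groupoid X F).
            src (bij_groupoid X F) b = rng (bij_groupoid X F) a \<and>
            rng (bij_groupoid X F) b = src (bij_groupoid X F) a \<and>
            cmp (bij_groupoid X F) b a = ident (bij_groupoid X F) (src (bij_groupoid X F) a) \<and>
            cmp (bij_groupoid X F) a b = ident (bij_groupoid X F) (rng (bij_groupoid X F) a)"
      using f g a by (intro bexI[of _ "(x, g, y)"]) simp_all
  }
  fix b :: "'a \<times> ('b \<Rightarrow> 'b) \<times> 'a"
  obtain y' g x' where b: "b = (y', g, x')" by (cases b)
  assume ab: "a \<in> arr (bij_groupoid X F)" "b \<in> arr (bij_groupoid X F)"
    "src (bij_groupoid X F) a = rng (bij_groupoid X F) b"
  then show "cmp (bij_groupoid X F) a b \<in> arr (bij_groupoid X F)"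
    "src (bij_groupoid X F) (cmp (bij_groupoid X F) a b) = src (bij_groupoid X F) b"
    "rng (bij_groupoid X F) (cmp (bij_groupoid X F) a b) = rng (bij_groupoid X F) a"
    using bij_betw_compose by (auto simp: a b)
  fix c :: "'a \<times> ('b \<Rightarrow> 'b) \<times> 'a"
  obtain y'' h x'' where c: "c = (y'', h, x'')" by (cases c)
  assume "c \<in> arr (bij_groupoid X F)" "src (bij_groupoid X F) b = rng (bij_groupoid X F) c"
  then have "h \<in> F x'' \<rightarrow> F x'" using b c by (auto dest: bij_betwE)
  then show "cmp (bij_groupoid X F) (cmp (bij_groupoid X F) a b) c =
       cmp (bij_groupoid X F) a (cmp (bij_groupoid X F) b c)"
    by (simp add: a b c compose_assoc)
next
  fix x assume "x \<in> obj (bij_groupoid X F)"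
  moreover have "bij_betw (\<lambda>v\<in>F x. v) (F x) (F x)"
    using bij_betw_cong[of "F x" "\<lambda>v\<in>F x. v" id "F x"] by simp
  ultimately show "ident (bij_groupoid X F) x \<in> arr (bij_groupoid X F)" by simp
qed simp_all

lemma (in groupoid_action) functor_bij_groupoid:
  "cat_functor G (bij_groupoid (obj G) VO) (\<lambda>x. x) (\<lambda>a. (rng G a, T a, src G a))"
proof -
  interpret B: groupoid "bij_groupoid (obj G) VO" by (rule groupoid_bij_groupoid)
  have "bij_betw (T a) (VO (src G a)) (VO (rng G a))" if a: "a \<in> arr G" for a
  proof (rule bij_betw_byWitness[where f' = "T (gpd_inv G a)"])
    note i = gpd_inv[OF a]
    note c = act_cmp[OF i(1) a i(2)] act_cmp[OF a i(1) i(3)[symmetric]]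
    note ai = act_ident[OF src_obj[OF a]] act_ident[OF rng_obj[OF a]]
    show "\<forall>v\<in>VO (src G a). T (gpd_inv G a) (T a v) = v"
      using fun_cong[OF c(1)] i ai by (metis compose_eq restrict_apply')
    show "\<forall>v\<in>VO (rng G a). T a (T (gpd_inv G a) v) = v"
      using fun_cong[OF c(2)] i ai by (metis compose_eq restrict_apply')
    show "T a ` VO (src G a) \<subseteq> VO (rng G a)" using act_fun[OF a] by auto
    show "T (gpd_inv G a) ` VO (rng G a) \<subseteq> VO (src G a)" using act_fun[OF i(1)] i by auto
  qed
  then show ?thesis
    using act_fun
    by unfold_locales (auto simp: src_obj rng_obj src_ident rng_ident act_ident src_cmp rng_cmp act_cmp
      simp del: bij_groupoid_simps(1) simp: bij_groupoid_simps PiE_def)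
qed

definition fibre :: "('o, 'a, 'z) cat_scheme \<Rightarrow> ('o \<Rightarrow> 'p) \<Rightarrow> 'p \<Rightarrow> 'o set" where
  "fibre Om pO x = {v \<in> obj Om. pO v = x}"

text \<open>The action exists and is unique by \<open>covering_action_unique\<close> below.\<close>

definition is_covering_action where
  "is_covering_action Om La pO pA T \<longleftrightarrow>
     groupoid_action (fundamental_groupoid La) (obj Om) (fibre Om pO) T
     \<and> (\<forall>l \<in> arr Om. T (fg_incl La (pA l)) (src Om l) = rng Om l)"

definition covering_action :: "('o, 'a, 'k::finite) kgraph \<Rightarrow> ('p, 'b, 'k) kgraph
    \<Rightarrow> ('o \<Rightarrow> 'p) \<Rightarrow> ('a \<Rightarrow> 'b) \<Rightarrow> ('p, 'b) walk_class \<Rightarrow> 'o \<Rightarrow> 'o" where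
  "covering_action Om La pO pA = (THE T. T \<in> extensional (arr (fundamental_groupoid La))
     \<and> is_covering_action Om La pO pA T)"

context k_graph_covering
begin

lemma lift_from:
  assumes "v \<in> obj Om" "b \<in> arr La" "src La b = pO v"
  shows "\<exists>!l. l \<in> arr Om \<and> src Om l = v \<and> pA l = b"
  using bij_src[OF assms(1)] assms(2,3) unfolding bij_betw_def inj_on_def image_iff set_eq_iff
  by (smt (verit) mem_Collect_eq)

lemma lift_to:
  assumes "v \<in> obj Om" "b \<in> arr La" "rng La b = pO v"
  shows "\<exists>!l. l \<in> arr Om \<and> rng Om l = v \<and> pA l = b"
  using bij_rng[OF assms(1)] assms(2,3) unfolding bij_betw_def inj_on_def image_iff set_eq_iff
  by (smt (verit) mem_Collect_eq)

text \<open>\<open>lft b v\<close> is the lift of \<open>b\<close> with source \<open>v\<close>; \<open>mon\<close> is the resulting functor to the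
  groupoid of bijections between the fibres.\<close>

definition lft where "lft b v = (THE l. l \<in> arr Om \<and> src Om l = v \<and> pA l = b)"

lemma lft:
  assumes "b \<in> arr La" "v \<in> fibre Om pO (src La b)"
  shows "lft b v \<in> arr Om" "src Om (lft b v) = v" "pA (lft b v) = b"
    and "rng Om (lft b v) \<in> fibre Om pO (rng La b)"
proof -
  have v: "v \<in> obj Om" "src La b = pO v" using assms(2) by (auto simp: fibre_def)
  show l: "lft b v \<in> arr Om" "src Om (lft b v) = v" "pA (lft b v) = b"
    using theI'[OF lift_from[OF v(1) assms(1) v(2)], folded lft_def] by auto
  show "rng Om (lft b v) \<in> fibre Om pO (rng La b)"
    using l map_rng[OF l(1)] dom.rng_obj[OF l(1)] by (simp add: fibre_def)
qed

lemma lft_eq: "l \<in> arr Om \<Longrightarrow> lft (pA l) (src Om l) = l"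
  unfolding lft_def using lift_from[OF dom.src_obj map_arr map_src]
  by (intro the1_equality) auto

definition mon where
  "mon b = (rng La b, \<lambda>v\<in>fibre Om pO (src La b). rng Om (lft b v), src La b)"

lemma mon_functor: "cat_functor La (bij_groupoid (obj La) (fibre Om pO)) (\<lambda>x. x) mon"
proof -
  interpret B: groupoid "bij_groupoid (obj La) (fibre Om pO)" by (rule groupoid_bij_groupoid)
  show ?thesis
  proof
    fix b assume b: "b \<in> arr La"
    have "inj_on (\<lambda>v. rng Om (lft b v)) (fibre Om pO (src La b))"
    proof (rule inj_onI)
      fix v w assume vw: "v \<in> fibre Om pO (src La b)" "w \<in> fibre Om pO (src La b)"
        "rng Om (lft b v) = rng Om (lft b w)"
      note l = lft[OF b vw(1)] and m = lft[OF b vw(2)]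
      have "rng La b = pO (rng Om (lft b v))" using l(4) by (simp add: fibre_def)
      from lift_to[OF dom.rng_obj[OF l(1)] b this] l(1-3) m(1-3) vw(3)
      have "lft b v = lft b w" by metis
      then show "v = w" using l m by metis
    qed
    moreover have "(\<lambda>v. rng Om (lft b v)) ` fibre Om pO (src La b) = fibre Om pO (rng La b)"
    proof
      show "(\<lambda>v. rng Om (lft b v)) ` fibre Om pO (src La b) \<subseteq> fibre Om pO (rng La b)"
        using lft(4)[OF b] by blast
      show "fibre Om pO (rng La b) \<subseteq> (\<lambda>v. rng Om (lft b v)) ` fibre Om pO (src La b)"
      proof
        fix u assume "u \<in> fibre Om pO (rng La b)"
        then have "u \<in> obj Om" "rng La b = pO u" by (auto simp: fibre_def)
        from lift_to[OF this(1) b this(2)] obtain l where l: "l \<in> arr Om" "rng Om l = u" "pA l = b"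
          by blast
        then have "src Om l \<in> fibre Om pO (src La b)" "lft b (src Om l) = l"
          using dom.src_obj[of l] map_src[of l] lft_eq[of l] by (auto simp: fibre_def)
        then show "u \<in> (\<lambda>v. rng Om (lft b v)) ` fibre Om pO (src La b)" using l by force
      qed
    qed
    ultimately have "bij_betw (\<lambda>v\<in>fibre Om pO (src La b). rng Om (lft b v))
        (fibre Om pO (src La b)) (fibre Om pO (rng La b))"
      by (simp add: bij_betw_def inj_on_def)
    then show "mon b \<in> arr (bij_groupoid (obj La) (fibre Om pO))"
      using b by (simp add: mon_def cod.src_obj cod.rng_obj)
  next
    fix x assume x: "x \<in> obj La"
    have "rng Om (lft (ident La x) v) = v" if "v \<in> fibre Om pO x" for v
    proof -
      have v: "v \<in> obj Om" "pO v = x" using that by (auto simp: fibre_def)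
      then show ?thesis
        using lft_eq[OF dom.ident_arr[OF v(1)]] by (simp add: dom.src_ident dom.rng_ident map_ident)
    qed
    then show "mon (ident La x) = ident (bij_groupoid (obj La) (fibre Om pO)) x"
      using x by (auto simp: mon_def cod.src_ident cod.rng_ident intro!: restrict_ext)
  next
    fix a b assume ab: "a \<in> arr La" "b \<in> arr La" "src La a = rng La b"
    have "rng Om (lft (cmp La a b) v) = rng Om (lft a (rng Om (lft b v)))"
      if v: "v \<in> fibre Om pO (src La b)" for v
    proof -
      note l = lft[OF ab(2) v]
      have "rng Om (lft b v) \<in> fibre Om pO (src La a)" using l ab by simp
      note m = lft[OF ab(1) this]
      from lft_eq[OF dom.cmp_arr[OF m(1) l(1)]] m l show ?thesis
        by (simp add: map_cmp dom.src_cmp dom.rng_cmp)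
    qed
    then show "mon (cmp La a b) = cmp (bij_groupoid (obj La) (fibre Om pO)) (mon a) (mon b)"
      using ab lft(4)[OF ab(2)]
      by (auto simp: mon_def cod.src_cmp cod.rng_cmp compose_def intro!: restrict_ext)
  qed (simp_all add: mon_def)
qed

lemma covering_action_unique:
  "\<exists>!T. T \<in> extensional (arr (fundamental_groupoid La)) \<and> is_covering_action Om La pO pA T"
proof -
  let ?G = "fundamental_groupoid La" and ?B = "bij_groupoid (obj La) (fibre Om pO)"
  interpret G: groupoid ?G by (rule cod.groupoid_fundamental_groupoid)
  have B: "groupoid ?B" by (rule groupoid_bij_groupoid)
  obtain M where M: "cat_functor ?G ?B (\<lambda>x. x) M" "\<And>b. b \<in> arr La \<Longrightarrow> M (fg_incl La b) = mon b"
    using fundamental_groupoid_universal[OF B mon_functor] by blast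
  interpret M: cat_functor ?G ?B "\<lambda>x. x" M by (rule M(1))
  define T where "T = restrict (\<lambda>a. fst (snd (M a))) (arr ?G)"
  have MT: "M a = (rng ?G a, T a, src ?G a)" if "a \<in> arr ?G" for a
    using M.map_src[OF that] M.map_rng[OF that] that by (cases "M a") (simp add: T_def)
  have act: "groupoid_action ?G (obj Om) (fibre Om pO) T"
  proof
    show "obj Om = (\<Union>x\<in>obj ?G. fibre Om pO x)" using map_obj by (auto simp: fibre_def)
    show "disjoint_family_on (fibre Om pO) (obj ?G)" by (auto simp: disjoint_family_on_def fibre_def)
  next
    fix a assume a: "a \<in> arr ?G"
    show "T a \<in> fibre Om pO (src ?G a) \<rightarrow>\<^sub>E fibre Om pO (rng ?G a)"
      using M.map_arr[OF a] unfolding MT[OF a] by (auto simp: PiE_def dest: bij_betwE)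
  next
    fix x assume x: "x \<in> obj ?G"
    show "T (ident ?G x) = (\<lambda>v\<in>fibre Om pO x. v)"
      using M.map_ident[OF x] unfolding MT[OF G.ident_arr[OF x]] by simp
  next
    fix a b assume ab: "a \<in> arr ?G" "b \<in> arr ?G" "src ?G a = rng ?G b"
    show "T (cmp ?G a b) = compose (fibre Om pO (src ?G b)) (T a) (T b)"
      using M.map_cmp[OF ab] unfolding MT[OF ab(1)] MT[OF ab(2)] MT[OF G.cmp_arr[OF ab]] by simp
  qed
  have "T (fg_incl La (pA l)) (src Om l) = rng Om l" if l: "l \<in> arr Om" for l
  proof -
    have b: "pA l \<in> arr La" "src Om l \<in> fibre Om pO (src La (pA l))"
      using l by (auto simp: map_arr map_src fibre_def dom.src_obj)
    then show ?thesis
      using M(2)[OF b(1)] MT[OF cod.fg_incl_arr[OF b(1)]] lft_eq[OF l] by (simp add: mon_def)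
  qed
  with act have 1: "is_covering_action Om La pO pA T" by (simp add: is_covering_action_def)
  show ?thesis
  proof (rule ex1I[of _ T])
    show "T \<in> extensional (arr ?G) \<and> is_covering_action Om La pO pA T" using 1 by (simp add: T_def)
    fix S assume S: "S \<in> extensional (arr ?G) \<and> is_covering_action Om La pO pA S"
    then interpret S: groupoid_action ?G "obj Om" "fibre Om pO" S by (simp add: is_covering_action_def)
    have SF: "cat_functor ?G ?B (\<lambda>x. x) (\<lambda>a. (rng ?G a, S a, src ?G a))"
      using S.functor_bij_groupoid by simp
    have "S (fg_incl La b) = T (fg_incl La b)" if b: "b \<in> arr La" for b
    proof (rule PiE_ext)
      show "S (fg_incl La b) \<in> fibre Om pO (src La b) \<rightarrow>\<^sub>E fibre Om pO (rng La b)"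
        using S.act_fun[OF cod.fg_incl_arr[OF b]] by simp
      show "T (fg_incl La b) \<in> fibre Om pO (src La b) \<rightarrow>\<^sub>E fibre Om pO (rng La b)"
        using groupoid_action.act_fun[OF act cod.fg_incl_arr[OF b]] by simp
      show "S (fg_incl La b) v = T (fg_incl La b) v" if v: "v \<in> fibre Om pO (src La b)" for v
      proof -
        note l = lft[OF b v]
        have "S (fg_incl La (pA (lft b v))) (src Om (lft b v)) = rng Om (lft b v)"
          "T (fg_incl La (pA (lft b v))) (src Om (lft b v)) = rng Om (lft b v)"
          using S 1 l(1) by (auto simp: is_covering_action_def)
        then show ?thesis by (simp add: l(2,3))
      qed
    qed
    then have incl: "(rng ?G (fg_incl La b), S (fg_incl La b), src ?G (fg_incl La b)) = M (fg_incl La b)"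
      if "b \<in> arr La" for b
      using MT[OF cod.fg_incl_arr[OF that]] that by simp
    have "S a = T a" if a: "a \<in> arr ?G" for a
      using fg_functor_unique[OF cod.category_axioms B SF M(1) incl a] MT[OF a] by simp
    then show "S = T" using S by (intro extensionalityI[of S "arr ?G" T]) (auto simp: T_def)
  qed
qed

lemma covering_action: "is_covering_action Om La pO pA (covering_action Om La pO pA)"
  using theI'[OF covering_action_unique] by (simp add: covering_action_def)

end

end

theory Submission
  imports Defs
begin

text \<open>Walks lift uniquely from a prescribed source, and each basic relation between walks in the base
  lifts to a relation between their lifts, so equivalent walks have equivalent lifts. This gives
  injectivity of the induced map. Since an arrow of the fundamental groupoid of the base acts by
  sending the source of a lift to its range, it fixes \<open>v\<close> exactly when its lift from \<open>v\<close> is a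
  loop, which identifies the image.\<close>

section \<open>Splitting walks into letters\<close>

abbreviation walk_map :: "('a \<Rightarrow> 'b) \<Rightarrow> ('a \<times> bool) list \<Rightarrow> ('b \<times> bool) list" where
  "walk_map f \<equiv> map (apfst f)"

lemma (in category) is_walk_Cons:
  "is_walk C y (l # w) x \<longleftrightarrow> (\<exists>z. is_walk C y [l] z \<and> is_walk C z w x)"
  using is_walk_append[of y "[l]" w x] by simp

text \<open>A letter determines both of its ends, so what remains after \<open>l\<close> must have
  range \<open>z\<close>. Classes of walks thereby factor one letter at a time.\<close>

lemma (in category) fg_Cons:
  assumes "is_walk C y (l # w) x" "is_walk C y [l] z"
  shows "is_walk C z w x"
    and "walk_class C y (l # w) x = cmp FG (walk_class C y [l] z) (walk_class C z w x)"
proof -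
  show w: "is_walk C z w x" using assms by (cases l) auto
  show "walk_class C y (l # w) x = cmp FG (walk_class C y [l] z) (walk_class C z w x)"
    using fg_cmp[OF assms(2) w] by simp
qed

text \<open>The reversed letter cancels the forward one, and inverses in a groupoid are unique.
  Writing reversed letters with \<open>gpd_inv\<close> makes them accessible to functors, which
  preserve inverses.\<close>

lemma (in category) fg_single_False:
  assumes "a \<in> arr C"
  shows "walk_class C (src C a) [(a, False)] (rng C a) = gpd_inv FG (fg_incl C a)" (is "?b = _")
proof -
  interpret F: groupoid FG by (rule groupoid_fundamental_groupoid)
  have w: "is_walk C (src C a) [(a, False)] (rng C a)" using assms by (simp add: rng_obj)
  have b: "cmp FG ?b (fg_incl C a) = ident FG (src C a)"
    using fg_cmp[OF w is_walk_single[OF assms]] walk_class_cong[OF fg_single_inverse(2)[OF assms]]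
    by (simp add: fg_incl_def fg_ident)
  note i = F.gpd_inv[OF fg_incl_arr[OF assms]]
  show ?thesis
    by (rule F.inverse_unique[OF fg_incl_arr[OF assms] fg_arr[OF w] i(1)]) (use b i in simp_all)
qed

section \<open>The induced functor on classes of walks\<close>

context cat_functor
begin

lemma is_walk_map: "is_walk C y w x \<Longrightarrow> is_walk D (FO y) (walk_map FA w) (FO x)"
  by (induction w arbitrary: y) (auto simp: map_obj map_arr map_src map_rng split: if_splits)

text \<open>A forward letter is an included arrow, where \<open>fg_map\<close> is prescribed; a
  reversed letter is the inverse of one.\<close>

lemma fg_map_single:
  assumes "is_walk C y [(a, e)] x"
  shows "fg_map C D FO FA (walk_class C y [(a, e)] x) = walk_class D (FO y) [(FA a, e)] (FO x)"
proof -
  interpret M: cat_functor "fundamental_groupoid C" "fundamental_groupoid D" FO "fg_map C D FO FA"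
    using fg_map(2)[OF cat_functor_axioms] .
  interpret FC: groupoid "fundamental_groupoid C" by (rule dom.groupoid_fundamental_groupoid)
  have a: "a \<in> arr C" using assms by simp
  note incl = fg_map(3)[OF cat_functor_axioms a]
  show ?thesis
  proof (cases e)
    case True
    then show ?thesis using assms incl by (auto simp: fg_incl_def map_src[OF a] map_rng[OF a])
  next
    case False
    then have yx: "y = src C a" "x = rng C a" using assms by auto
    note i = FC.gpd_inv[OF dom.fg_incl_arr[OF a]]
    have "fg_map C D FO FA (gpd_inv (fundamental_groupoid C) (fg_incl C a))
        = gpd_inv (fundamental_groupoid D) (fg_incl D (FA a))"
      using cat_functor_inverse[OF M.cat_functor_axioms cod.groupoid_fundamental_groupoid
          dom.fg_incl_arr[OF a] i(1-4)] incl by simp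
    then show ?thesis
      using False yx dom.fg_single_False[OF a] cod.fg_single_False[OF map_arr[OF a]]
      by (simp add: map_src[OF a] map_rng[OF a])
  qed
qed

text \<open>Makes \<open>fg_map\<close>, which is given only by its universal property, computable
  on representatives: functoriality reduces the claim to single letters.\<close>

lemma fg_map_walk_class:
  assumes "is_walk C y w x"
  shows "fg_map C D FO FA (walk_class C y w x) = walk_class D (FO y) (walk_map FA w) (FO x)"
proof -
  interpret M: cat_functor "fundamental_groupoid C" "fundamental_groupoid D" FO "fg_map C D FO FA"
    using fg_map(2)[OF cat_functor_axioms] .
  show ?thesis using assms
  proof (induction w arbitrary: y)
    case Nil
    then show ?case using M.map_ident[of x] by (simp add: dom.fg_ident cod.fg_ident)
  next
    case (Cons l w)
    obtain a e where l: "l = (a, e)" by force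
    obtain z where z: "is_walk C y [l] z"
      using dom.is_walk_Cons Cons.prems by blast
    note w = dom.fg_Cons[OF Cons.prems z]
    note v = cod.fg_Cons[OF is_walk_map[OF Cons.prems, simplified] is_walk_map[OF z, simplified]]
    show ?case
      using w v fg_map_single[OF z[unfolded l]] Cons.IH[OF w(1)]
        M.map_cmp[OF dom.fg_arr[OF z] dom.fg_arr[OF w(1)]]
      by (simp add: l)
  qed
qed

end

section \<open>Lifting walks and their equivalences along a covering\<close>

context k_graph_covering
begin

lemma arr_eqI_src:
  "\<lbrakk>a \<in> arr Om; a' \<in> arr Om; pA a = pA a'; src Om a = src Om a'\<rbrakk> \<Longrightarrow> a = a'"
  using lft_eq by metis

lemma arr_eqI_rng:
  "\<lbrakk>a \<in> arr Om; a' \<in> arr Om; pA a = pA a'; rng Om a = rng Om a'\<rbrakk> \<Longrightarrow> a = a'"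
  by (rule inj_onD[OF bij_betw_imp_inj_on[OF bij_rng[OF dom.rng_obj]]]) auto

text \<open>The source \<open>u\<close> sits at the end of the list, so the tails are compared
  first. Their common range is the source of a forward leading letter or the range of a reversed
  one, and the covering is injective on arrows with either end fixed.\<close>

lemma walk_lift_unique:
  "\<lbrakk>is_walk Om v w u; is_walk Om v' w' u; walk_map pA w = walk_map pA w'\<rbrakk> \<Longrightarrow> v = v' \<and> w = w'"
proof (induction w arbitrary: v v' w')
  case Nil
  then show ?case by auto
next
  case (Cons l w)
  obtain a e where l: "l = (a, e)" by force
  obtain a' t where w': "w' = (a', e) # t" "pA a = pA a'" "walk_map pA w = walk_map pA t"
    using Cons.prems(3) l by (cases w') auto
  have a: "a \<in> arr Om" "a' \<in> arr Om" using Cons.prems w' l by auto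
  have "(if e then src Om a else rng Om a) = (if e then src Om a' else rng Om a') \<and> w = t"
    by (rule Cons.IH[OF _ _ w'(3)]) (use Cons.prems(1,2) w'(1) l in simp_all)
  moreover from this have "a = a'"
    by (cases e) (auto intro: arr_eqI_src[OF a w'(2)] arr_eqI_rng[OF a w'(2)])
  ultimately show ?case using Cons.prems(1,2) l w'(1) by auto
qed

text \<open>Lifting also proceeds from the end of the list: a forward letter is lifted with
  prescribed source, a reversed one with prescribed range.\<close>

lemma walk_lift_exists:
  "\<lbrakk>is_walk La y w (pO u); u \<in> obj Om\<rbrakk> \<Longrightarrow> \<exists>v w'. is_walk Om v w' u \<and> walk_map pA w' = w \<and> pO v = y"
proof (induction w arbitrary: y)
  case Nil
  then show ?case by (intro exI[of _ u] exI[of _ "[]"]) auto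
next
  case (Cons l w)
  obtain b e where l: "l = (b, e)" by force
  have b: "b \<in> arr La" "is_walk La (if e then src La b else rng La b) w (pO u)"
    "y = (if e then rng La b else src La b)" using Cons.prems l by auto
  obtain v w' where w': "is_walk Om v w' u" "walk_map pA w' = w"
    "pO v = (if e then src La b else rng La b)" using Cons.IH[OF b(2) Cons.prems(2)] by blast
  have v: "v \<in> obj Om" using dom.is_walk_obj w'(1) by blast
  obtain a where a: "a \<in> arr Om" "pA a = b" "v = (if e then src Om a else rng Om a)"
    using lift_from[OF v b(1)] lift_to[OF v b(1)] w'(3) by (cases e) auto
  show ?case
    using a b w' l map_src[OF a(1)] map_rng[OF a(1)]
    by (intro exI[of _ "if e then rng Om a else src Om a"] exI[of _ "(a, e) # w'"]) auto
qed

lemma basic_rel_lift: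
  assumes "basic_rel La w w'" "is_walk Om v t u" "walk_map pA t = w"
  shows "\<exists>t'. basic_rel Om t t' \<and> is_walk Om v t' u \<and> walk_map pA t' = w'"
  using assms(1)
proof cases
  case (basic_ident x)
  then obtain a where a: "t = [(a, True)]" "pA a = ident La x" using assms(3) by auto
  then have w: "a \<in> arr Om" "v = rng Om a" "u = src Om a" "u \<in> obj Om" using assms(2) by auto
  have "pO u = x" using map_src[OF w(1)] w(3) a(2) basic_ident(3) by (simp add: cod.src_ident)
  \<comment> \<open>The identity at \<open>u\<close> is a competing lift with the same source, so
    \<open>t\<close> must be that letter.\<close>
  then have "walk_map pA t = walk_map pA [(ident Om u, True)]"
    using a w by (simp add: map_ident)
  moreover have "is_walk Om u [(ident Om u, True)] u"
    using w by (simp add: dom.ident_arr dom.src_ident dom.rng_ident)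
  ultimately have "v = u" "t = [(ident Om u, True)]" using walk_lift_unique assms(2) by blast+
  then show ?thesis using w basic_ident basic_rel.basic_ident[of u Om] by (intro exI[of _ "[]"]) auto
next
  case (basic_cmp a b)
  then obtain a' b' where "t = [(a', True), (b', True)]" "pA a' = a" "pA b' = b"
    using assms(3) by auto
  then show ?thesis
    using assms(2) basic_cmp basic_rel.basic_cmp[of a' Om b']
    by (intro exI[of _ "[(cmp Om a' b', True)]"])
       (auto simp: dom.cmp_arr dom.src_cmp dom.rng_cmp map_cmp)
next
  case (basic_inv b e)
  then obtain a a' where t: "t = [(a, e), (a', \<not> e)]" "pA a = b" "pA a' = b"
    using assms(3) by auto
  \<comment> \<open>The two letters meet at a common source or a common range, so their equal images
    force them to be the same arrow.\<close>
  have a: "a \<in> arr Om" "a' \<in> arr Om" "(if e then src Om a = src Om a' else rng Om a = rng Om a')"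
    using assms(2) t by auto
  then have "a = a'"
    using t(2,3) arr_eqI_src[OF a(1,2)] arr_eqI_rng[OF a(1,2)] by metis
  then show ?thesis
    using t a assms(2) basic_inv basic_rel.basic_inv[OF a(1), of e] by (intro exI[of _ "[]"]) auto
qed

text \<open>The analogue of homotopy lifting. That the lift of \<open>w'\<close> again has range
  \<open>v\<close> is part of the conclusion; this is what detects loops upstairs.\<close>

lemma walk_eq_lift:
  "\<lbrakk>walk_eq La y x w w'; is_walk Om v t u; walk_map pA t = w; pO u = x\<rbrakk>
    \<Longrightarrow> \<exists>t'. walk_eq Om v u t t' \<and> walk_map pA t' = w'"
proof (induction arbitrary: v t rule: walk_eq.induct)
  case (walk_refl w)
  then show ?case using walk_eq.walk_refl by (intro exI[of _ t]) simp
next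
  case (walk_sym w w')
  have u: "u \<in> obj Om" using walk_sym.prems dom.is_walk_obj by blast
  \<comment> \<open>The induction hypothesis transports lifts of \<open>w\<close>, but
    \<open>t\<close> lies over \<open>w'\<close>. Hence \<open>w\<close> is lifted afresh from
    \<open>u\<close>, transported, and the result identified with \<open>t\<close> by
    uniqueness.\<close>
  have "is_walk La y w (pO u)" using walk_sym cod.walk_eq_is_walk by blast
  then obtain v' s where s: "is_walk Om v' s u" "walk_map pA s = w"
    using walk_lift_exists u by blast
  then obtain s' where s': "walk_eq Om v' u s s'" "walk_map pA s' = w'"
    using walk_sym by blast
  then have "v' = v \<and> s' = t"
    using walk_sym.prems dom.walk_eq_is_walk[OF s'(1)] by (intro walk_lift_unique[of _ _ u]) auto
  then show ?case using s(2) walk_eq.walk_sym[OF s'(1)] by (intro exI[of _ s]) simp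
next
  case (walk_trans w w' w'')
  obtain t' where t': "walk_eq Om v u t t'" "walk_map pA t' = w'"
    using walk_trans.IH(1) walk_trans.prems by blast
  obtain t'' where t'': "walk_eq Om v u t' t''" "walk_map pA t'' = w''"
    using walk_trans.IH(2)[OF _ t'(2) walk_trans.prems(3)] dom.walk_eq_is_walk[OF t'(1)] by blast
  then show ?case using walk_eq.walk_trans[OF t'(1) t''(1)] by blast
next
  case (walk_step w w' r r')
  \<comment> \<open>Only the part of \<open>t\<close> over the rewritten segment changes; since its
    replacement keeps both ends, the outer parts still fit.\<close>
  obtain s1 s2 s3 where s: "t = s1 @ s2 @ s3" "walk_map pA s1 = r" "walk_map pA s2 = w"
    "walk_map pA s3 = r'"
    using walk_step.prems(2) by (auto simp: map_eq_append_conv append_eq_map_conv)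
  obtain z z' where z: "is_walk Om v s1 z" "is_walk Om z s2 z'" "is_walk Om z' s3 u"
    using walk_step.prems(1) unfolding s(1) dom.is_walk_append by blast
  obtain s2' where s2': "basic_rel Om s2 s2'" "is_walk Om z s2' z'" "walk_map pA s2' = w'"
    using basic_rel_lift[OF walk_step(1) z(2) s(3)] by blast
  have "is_walk Om v (s1 @ s2' @ s3) u" using z s2' unfolding dom.is_walk_append by blast
  then have "walk_eq Om v u t (s1 @ s2' @ s3)"
    using walk_eq.walk_step[OF s2'(1)] walk_step.prems(1) s(1) by simp
  then show ?case using s s2' by (intro exI[of _ "s1 @ s2' @ s3"]) simp
qed

section \<open>The induced functor of a covering and the action on vertices\<close>

abbreviation "p_star \<equiv> fg_map Om La pO pA"

lemma p_star_functor: "cat_functor (fundamental_groupoid Om) (fundamental_groupoid La) pO p_star"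
  using fg_map(2)[OF cat_functor_axioms] .

text \<open>Transporting \<open>w\<close> along the equivalence of the images yields a walk over the
  same walk as \<open>w'\<close> with the same source, hence \<open>w'\<close> itself. Equality of
  the ranges comes out of this as well.\<close>

lemma p_star_inj:
  assumes "c \<in> arr (fundamental_groupoid Om)" "d \<in> arr (fundamental_groupoid Om)"
    "src (fundamental_groupoid Om) c = src (fundamental_groupoid Om) d" "p_star c = p_star d"
  shows "c = d"
proof -
  obtain v w u where c: "is_walk Om v w u" "c = walk_class Om v w u"
    using assms(1) by (rule dom.fg_arrE)
  obtain v' w' u' where d: "is_walk Om v' w' u'" "d = walk_class Om v' w' u'"
    using assms(2) by (rule dom.fg_arrE)
  have u: "u' = u" using assms(3) c d by simp
  have "walk_eq La (pO v) (pO u) (walk_map pA w) (walk_map pA w')"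
    using assms(4) fg_map_walk_class[OF c(1)] fg_map_walk_class[OF d(1)]
      cod.walk_class_eq_iff[OF is_walk_map[OF c(1)]] unfolding c(2) d(2) u by metis
  from walk_eq_lift[OF this c(1)] obtain t where t: "walk_eq Om v u w t"
    "walk_map pA t = walk_map pA w'" by auto
  then have "v = v' \<and> t = w'" using walk_lift_unique d(1) u dom.walk_eq_is_walk by blast
  then show ?thesis using t c d u dom.walk_class_cong by simp
qed

lemma p_star_lift:
  assumes "a \<in> arr (fundamental_groupoid La)" "u \<in> fibre Om pO (src (fundamental_groupoid La) a)"
  shows "\<exists>c \<in> arr (fundamental_groupoid Om). src (fundamental_groupoid Om) c = u \<and> p_star c = a"
proof -
  obtain y w x where a: "is_walk La y w x" "a = walk_class La y w x"
    using assms(1) by (rule cod.fg_arrE)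
  have u: "u \<in> obj Om" "pO u = x" using assms(2) a by (auto simp: fibre_def)
  then obtain v w' where w': "is_walk Om v w' u" "walk_map pA w' = w" "pO v = y"
    using walk_lift_exists[of y w u] a(1) by blast
  then show ?thesis
    using dom.fg_arr[OF w'(1)] fg_map_walk_class[OF w'(1)] a(2) u
    by (intro bexI[of _ "walk_class Om v w' u"]) auto
qed

text \<open>The formula defines the action on included arrows. It is stable under composition and
  inversion, and these arrows together with the identities generate the groupoid.\<close>

lemma covering_action_p_star:
  assumes "c \<in> arr (fundamental_groupoid Om)"
  shows "covering_action Om La pO pA (p_star c) (src (fundamental_groupoid Om) c)
    = rng (fundamental_groupoid Om) c"
proof -
  let ?T = "covering_action Om La pO pA"
  interpret F: groupoid "fundamental_groupoid Om" by (rule dom.groupoid_fundamental_groupoid)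
  interpret M: cat_functor "fundamental_groupoid Om" "fundamental_groupoid La" pO p_star
    by (rule p_star_functor)
  interpret T: groupoid_action "fundamental_groupoid La" "obj Om" "fibre Om pO" ?T
    using covering_action by (simp add: is_covering_action_def)
  \<comment> \<open>The maps of the action are extensional, so the composition law can be evaluated
    only at points of the right fibre.\<close>
  have fib: "src (fundamental_groupoid Om) c
      \<in> fibre Om pO (src (fundamental_groupoid La) (p_star c))"
    if "c \<in> arr (fundamental_groupoid Om)" for c
    using F.src_obj[OF that] M.map_src[OF that] by (simp add: fibre_def)
  have T_cmp: "?T (p_star (cmp (fundamental_groupoid Om) a b)) (src (fundamental_groupoid Om) b)
      = ?T (p_star a) (?T (p_star b) (src (fundamental_groupoid Om) b))"
    if "a \<in> arr (fundamental_groupoid Om)" "b \<in> arr (fundamental_groupoid Om)"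
      "src (fundamental_groupoid Om) a = rng (fundamental_groupoid Om) b" for a b
    using that fib[OF that(2)]
    by (simp add: M.map_cmp T.act_cmp M.map_arr M.map_src M.map_rng compose_eq)
  have T_ident: "?T (p_star (ident (fundamental_groupoid Om) v)) v = v" if "v \<in> obj Om" for v
    using that map_obj by (simp add: M.map_ident T.act_ident fibre_def)
  show ?thesis using assms
  proof (induction rule: dom.fg_induct)
    case (ident x)
    then show ?case using T_ident by (simp add: F.src_ident F.rng_ident)
  next
    case (incl a)
    then show ?case
      using covering_action fg_map(3)[OF cat_functor_axioms] by (simp add: is_covering_action_def)
  next
    \<comment> \<open>The product \<open>ba\<close> acts as an identity on the source of
      \<open>a\<close>, which \<open>a\<close> moves to its range; so \<open>b\<close> moves that
      range back.\<close>
    case (inverse a b)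
    then show ?case
      using T_cmp[of b a] T_ident F.src_obj[OF inverse(1)] by simp
  next
    case (cmp a b)
    then show ?case using T_cmp by (simp add: F.src_cmp F.rng_cmp)
  qed
qed

end

theorem corollary3p9:
  fixes Om :: "('o, 'a, 'k::finite) kgraph" and La :: "('p, 'b, 'k) kgraph"
    and pO :: "'o \<Rightarrow> 'p" and pA :: "'a \<Rightarrow> 'b" and x :: 'p and v :: 'o
  assumes "k_graph_covering Om La pO pA"
    and "x \<in> obj La"
    and "v \<in> fibre Om pO x"
  shows "fg_map Om La pO pA \<in> iso (fundamental_group Om v)
    ((fundamental_group La x)\<lparr>carrier :=
      stability (fundamental_groupoid La) (fibre Om pO) (covering_action Om La pO pA) v\<rparr>)"
proof -
  interpret k_graph_covering Om La pO pA by fact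
  let ?T = "covering_action Om La pO pA" and ?GO = "fundamental_groupoid Om"
    and ?GL = "fundamental_groupoid La"
  interpret M: cat_functor ?GO ?GL pO p_star by (rule p_star_functor)
  \<comment> \<open>This is the carrier of \<open>fundamental_group Om v\<close>.\<close>
  define K where "K = {c \<in> arr ?GO. rng ?GO c = v \<and> src ?GO c = v}"
  have "inj_on p_star K"
    by (rule inj_onI) (use p_star_inj in \<open>auto simp: K_def\<close>)
  moreover have "p_star ` K = stability ?GL (fibre Om pO) ?T v"
  proof
    have "p_star c \<in> stability ?GL (fibre Om pO) ?T v" if "c \<in> K" for c
      using that covering_action_p_star[of c] assms(3) M.map_arr[of c] M.map_src[of c]
      by (auto simp: K_def stability_def fibre_def)
    then show "p_star ` K \<subseteq> stability ?GL (fibre Om pO) ?T v" by blast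
    show "stability ?GL (fibre Om pO) ?T v \<subseteq> p_star ` K"
    proof
      fix a assume "a \<in> stability ?GL (fibre Om pO) ?T v"
      then have a: "a \<in> arr ?GL" "v \<in> fibre Om pO (src ?GL a)" "?T a v = v"
        by (auto simp: stability_def)
      then obtain c where c: "c \<in> arr ?GO" "src ?GO c = v" "p_star c = a"
        using p_star_lift by blast
      \<comment> \<open>The lift \<open>c\<close> starts at \<open>v\<close>, and its range is the
        image of \<open>v\<close> under \<open>a\<close>; since \<open>a\<close> fixes
        \<open>v\<close>, the lift is a loop.\<close>
      then have "rng ?GO c = v" using covering_action_p_star[OF c(1)] a(3) by simp
      then show "a \<in> p_star ` K" using c by (auto simp: K_def)
    qed
  qed
  ultimately have "bij_betw p_star K (stability ?GL (fibre Om pO) ?T v)"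
    by (simp add: bij_betw_def)
  moreover have "p_star (cmp ?GO c d) = cmp ?GL (p_star c) (p_star d)" if "c \<in> K" "d \<in> K" for c d
    using that M.map_cmp by (simp add: K_def)
  ultimately show ?thesis
    by (auto simp: iso_def hom_def fundamental_group_def vertex_group_def K_def[symmetric]
      bij_betwE Pi_iff)
qed

end
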